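(* Consider the fully discrete implicit-explicit scheme described in the context: $u^0_{i,j}=g_0'(x_{1_i},x_{2_j})$ and, for $n\ge1$ with $\tau_n=n\triangle\tau\le T$, $$\frac{u^n_{i,j}-u^{n-1}_{i,j}}{\triangle\tau}+(B_{\rho'}u^n)_{i,j}+ru^n_{i,j}=(Ku^{n-1})_{i,j}+F^n_{i,j}$$ at all inner nodes and all nodes of the Neumann part of the boundary, with $u^n_{i,j}=g_2'(x_{1_i},x_{2_j},\tau_n)$ at the nodes on Dirichlet sides. Set $b_Q=1$ if the side $\partial\Omega'_Q$ is a Dirichlet side and $b_Q=0$ otherwise, $Q\in\{W,E,N,S\}$. If $g_0',g_1',g_2'\ge0$, if at every time level $$\frac{\sigma_1}{\sigma_2}\max_{\substack{1+b_W\le i\le N_1-b_E\\ 1+b_S\le j\le N_2-b_N}}|\rho'_{i,j}|\ \le\ \frac{h_1}{h_2}\ \le\ \frac{\sigma_1}{\sigma_2\max\limits_{\substack{1+b_W\le i\le N_1-b_E\\ 1+b_S\le j\le N_2-b_N}}|\rho'_{i,j}|}$$ (right-hand side $+\infty$ if the maximum is $0$), and if $$\triangle\tau\le\frac{h_1h_2}{2(|A_1|h_2+|A_2|h_1)}$$ (no restriction if $A_1=A_2=0$), then the numerical solution is non-negative: $u^n_{i,j}\ge0$ for all $i,j$ and all $n$ with $\tau_n\le T$.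
   Context: Parameters: $\sigma_1,\sigma_2,r,T>0$, $D_1,D_2\in\mathbb{R}$, $-1\le\rho_1\le\rho_2\le1$; $A_s=r-D_s-\frac12\sigma_s^2$, $s=1,2$. For real $v$: $v^+=\max\{0,v\}$, $v^-=\max\{0,-v\}$, so $v=v^+-v^-$, $|v|=v^++v^-$. Continuous problem: $u_\tau-\frac12\sigma_1^2u_{x_1x_1}-\frac12\sigma_2^2u_{x_2x_2}-\rho(u_{x_1x_2})\sigma_1\sigma_2u_{x_1x_2}-A_1u_{x_1}-A_2u_{x_2}+ru=0$ on the rectangle $\Omega'=(\ln L_W,\ln L_E)\times(\ln L_S,\ln L_N)$, $0<\tau<T$, $u(\cdot,0)=g_0'$, with $\rho(\gamma)=\rho_1$ for $\gamma>0$, $\rho(\gamma)=\rho_2$ for $\gamma<0$ (at $\gamma=0$ either value may be used). It is the worst-case two-asset option pricing problem for $V(S_1,S_2,t)=u(x_1,x_2,\tau)$ in the variables $x_i=\ln S_i$, $\tau=T-t$, so the node values are also the numerical values of $V$. Each closed side $\partial\Omega'_W$ ($x_1=\ln L_W$), $\partial\Omega'_E$ ($x_1=\ln L_E$), $\partial\Omega'_S$ ($x_2=\ln L_S$), $\partial\Omega'_N$ ($x_2=\ln L_N$) is either a Dirichlet side (part of $\partial\Omega_2'$, $u=g_2'$) or a Neumann side (part of $\partial\Omega_1'$, outward normal derivative $=g_1'$); $\partial\Omega_2'\neq\emptyset$. A corner belonging to a Dirichlet side is a Dirichlet node. $g^W,g^E,g^S,g^N$ denote the Neumann datum $g_1'$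 on the respective side; on a side ending at a corner between two Neumann sides the datum is also given (with the same sign assumption) at the ghost node one mesh step beyond the corner. Mesh: uniform, nodes $(x_{1_i},x_{2_j})$, $x_{1_i}=\ln L_W+(i-1)h_1$, $x_{2_j}=\ln L_S+(j-1)h_2$, $1\le i\le N_1$, $1\le j\le N_2$, $h_1=\ln(L_E/L_W)/(N_1-1)$, $h_2=\ln(L_N/L_S)/(N_2-1)$, $N_1,N_2\ge4$; time step $\triangle\tau>0$. Differences: $u_{\overline{x}_1}=(u_{i,j}-u_{i-1,j})/h_1$, $u_{x_1}=(u_{i+1,j}-u_{i,j})/h_1$, $u_{\mathring{x}_1}=\frac12(u_{x_1}+u_{\overline{x}_1})$, similarly in $x_2$ with $j,h_2$; iterated subscripts denote composition; $u^+_{x_1x_2}=\frac12(u_{x_1x_2}+u_{\overline{x}_1\overline{x}_2})$, $u^-_{x_1x_2}=\frac12(u_{\overline{x}_1x_2}+u_{x_1\overline{x}_2})$. Differences of Neumann data are taken along the side. Flux limiter: $\Phi(\theta)=\frac{|\theta|+\theta}{1+|\theta|}$. For $s=1$ put $\theta_{e_1+1/2}=u_{x_1}/u_{\overline{x}_1}$ evaluated at $(i,j)$, and $\theta_{e_1+3/2},\theta_{e_1-1/2}$ the same ratio at $(i+1,j),(i-1,j)$; analogously for $s=2$ in $j$. $\Lambda_s^+=1+\frac12\Phi(\theta_{e_s+1/2}^{-1})-\frac12\Phi(\theta_{e_s+3/2})$, $\Lambda_s^-=1+\frac12\Phi(\theta_{e_s+1/2})-\frac12\Phi(\theta_{e_s-1/2}^{-1})$,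 so that $0\le\Lambda_s^\pm\le2$ (when a denominator vanishes any convention keeping $\Lambda_s^\pm\in[0,2]$ may be used). Outer values needed in these ratios are extrapolated: $u_{0,j}=3u_{1,j}-3u_{2,j}+u_{3,j}$, $u_{N_1+1,j}=3u_{N_1,j}-3u_{N_1-1,j}+u_{N_1-2,j}$, and likewise in $j$. Time levels: in the step from $\tau_{n-1}$ to $\tau_n$, all $\rho'_{i,j}$ and $\Lambda_s^\pm$ are evaluated at the old level $\tau_{n-1}$ (from $u^{n-1}$ and the Neumann data at $\tau_{n-1}$), $K$ acts on $u^{n-1}$, $B_{\rho'}$ acts on $u^n$, and the Neumann data appearing in $F^n$ are taken at $\tau_n$. Scheme (write $\rho'=\rho'_{i,j}$, $\kappa=\sigma_1\sigma_2$; $K_1=A_1^+\Lambda_1^+u_{x_1}-A_1^-\Lambda_1^-u_{\overline{x}_1}$, $K_2=A_2^+\Lambda_2^+u_{x_2}-A_2^-\Lambda_2^-u_{\overline{x}_2}$): Inner nodes ($2\le i\le N_1-1$, $2\le j\le N_2-1$): $B_{\rho'}u=-\frac12\sigma_1^2u_{\overline{x}_1x_1}-\frac12\sigma_2^2u_{\overline{x}_2x_2}-\kappa(\rho'^+u^+_{x_1x_2}-\rho'^-u^-_{x_1x_2})$, $Ku=K_1+K_2$, $F=0$, $\rho'=\rho(u_{\mathring{x}_1\mathring{x}_2})$. West ($i=1$, $1<j<N_2$): $B_{\rho'}u=-\frac{\sigma_1^2}{h_1}u_{x_1}-\frac12\sigma_2^2u_{\overline{x}_2x_2}-\frac{\kappa}{2}|\rho'|(u_{x_1x_2}-u_{x_1\overline{x}_2})$,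 $Ku=A_1^+\Lambda_1^+u_{x_1}+K_2$, $F=(A_1^-+\frac{\sigma_1^2}{h_1})g^W-\kappa(\rho'^+g^W_{\overline{x}_2}-\rho'^-g^W_{x_2})$, $\rho'=\rho(-g^W_{\mathring{x}_2})$. East ($i=N_1$, $1<j<N_2$): $B_{\rho'}u=\frac{\sigma_1^2}{h_1}u_{\overline{x}_1}-\frac12\sigma_2^2u_{\overline{x}_2x_2}-\frac{\kappa}{2}|\rho'|(u_{\overline{x}_1\overline{x}_2}-u_{\overline{x}_1x_2})$, $Ku=-A_1^-\Lambda_1^-u_{\overline{x}_1}+K_2$, $F=(A_1^++\frac{\sigma_1^2}{h_1})g^E+\kappa(\rho'^+g^E_{x_2}-\rho'^-g^E_{\overline{x}_2})$, $\rho'=\rho(g^E_{\mathring{x}_2})$. North ($j=N_2$, $1<i<N_1$): $B_{\rho'}u=-\frac12\sigma_1^2u_{\overline{x}_1x_1}+\frac{\sigma_2^2}{h_2}u_{\overline{x}_2}-\frac{\kappa}{2}|\rho'|(u_{\overline{x}_1\overline{x}_2}-u_{x_1\overline{x}_2})$, $Ku=K_1-A_2^-\Lambda_2^-u_{\overline{x}_2}$, $F=(A_2^++\frac{\sigma_2^2}{h_2})g^N+\kappa(\rho'^+g^N_{x_1}-\rho'^-g^N_{\overline{x}_1})$, $\rho'=\rho(g^N_{\mathring{x}_1})$. South ($j=1$, $1<i<N_1$): $B_{\rho'}u=-\frac12\sigma_1^2u_{\overline{x}_1x_1}-\frac{\sigma_2^2}{h_2}u_{x_2}-\frac{\kappa}{2}|\rho'|(u_{x_1x_2}-u_{\overline{x}_1x_2})$,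 $Ku=K_1+A_2^+\Lambda_2^+u_{x_2}$, $F=(A_2^-+\frac{\sigma_2^2}{h_2})g^S-\kappa(\rho'^+g^S_{\overline{x}_1}-\rho'^-g^S_{x_1})$, $\rho'=\rho(-g^S_{\mathring{x}_1})$. Corners between two Neumann sides: NW $(1,N_2)$: $B_{\rho'}u=-\frac{\sigma_1^2}{h_1}u_{x_1}+\frac{\sigma_2^2}{h_2}u_{\overline{x}_2}+\kappa|\rho'|u_{x_1\overline{x}_2}$, $Ku=A_1^+\Lambda_1^+u_{x_1}-A_2^-\Lambda_2^-u_{\overline{x}_2}$, $F=(A_1^-+\frac{\sigma_1^2}{h_1})g^W+(A_2^++\frac{\sigma_2^2}{h_2})g^N+\kappa\rho'^+(g^N_{x_1}-g^W_{\overline{x}_2})+\kappa\rho'^-(g^N_{x_1}-g^W_{\overline{x}_2}+g^W_{\mathring{x}_2}-g^N_{\mathring{x}_1})$, $\rho'=\rho(g^N_{\mathring{x}_1}-g^W_{\mathring{x}_2})$. NE $(N_1,N_2)$: $B_{\rho'}u=\frac{\sigma_1^2}{h_1}u_{\overline{x}_1}+\frac{\sigma_2^2}{h_2}u_{\overline{x}_2}-\kappa|\rho'|u_{\overline{x}_1\overline{x}_2}$, $Ku=-A_1^-\Lambda_1^-u_{\overline{x}_1}-A_2^-\Lambda_2^-u_{\overline{x}_2}$, $F=(A_1^++\frac{\sigma_1^2}{h_1})g^E+(A_2^++\frac{\sigma_2^2}{h_2})g^N-\kappa\rho'^+(g^N_{\overline{x}_1}+g^E_{\overline{x}_2}-g^E_{\mathring{x}_2}-g^N_{\mathring{x}_1})-\kappa\rho'^-(g^N_{\overline{x}_1}+g^E_{\overline{x}_2})$,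 $\rho'=\rho(g^N_{\mathring{x}_1}+g^E_{\mathring{x}_2})$. SE $(N_1,1)$: $B_{\rho'}u=\frac{\sigma_1^2}{h_1}u_{\overline{x}_1}-\frac{\sigma_2^2}{h_2}u_{x_2}+\kappa|\rho'|u_{\overline{x}_1x_2}$, $Ku=-A_1^-\Lambda_1^-u_{\overline{x}_1}+A_2^+\Lambda_2^+u_{x_2}$, $F=(A_1^++\frac{\sigma_1^2}{h_1})g^E+(A_2^-+\frac{\sigma_2^2}{h_2})g^S-\kappa\rho'^+(g^S_{\overline{x}_1}-g^E_{x_2})-\kappa\rho'^-(g^S_{\overline{x}_1}-g^E_{x_2}-g^S_{\mathring{x}_1}+g^E_{\mathring{x}_2})$, $\rho'=\rho(g^E_{\mathring{x}_2}-g^S_{\mathring{x}_1})$. SW $(1,1)$: $B_{\rho'}u=-\frac{\sigma_1^2}{h_1}u_{x_1}-\frac{\sigma_2^2}{h_2}u_{x_2}-\kappa|\rho'|u_{x_1x_2}$, $Ku=A_1^+\Lambda_1^+u_{x_1}+A_2^+\Lambda_2^+u_{x_2}$, $F=(A_1^-+\frac{\sigma_1^2}{h_1})g^W+(A_2^-+\frac{\sigma_2^2}{h_2})g^S+\kappa\rho'^+(g^S_{x_1}+g^W_{x_2})+\kappa\rho'^-(g^S_{x_1}+g^W_{x_2}-g^S_{\mathring{x}_1}-g^W_{\mathring{x}_2})$, $\rho'=\rho(-g^S_{\mathring{x}_1}-g^W_{\mathring{x}_2})$. *)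

theory Defs
  imports Complex_Main
begin

section \<open>Data of the problem\<close>

datatype side = West | East | South | North

text \<open>
  The sides listed in \<open>dirichlet\<close> form the Dirichlet part of the boundary, the remaining ones the
  Neumann part. The data are \<open>g_init x1 x2\<close>, \<open>g_dir x1 x2 \<tau>\<close> and \<open>g_neu Q x1 x2 \<tau>\<close>. The
  outward normal derivative carries the side \<open>Q\<close> as an argument because it is double-valued at a
  corner of two Neumann sides, and because it is also read at a point beyond such a corner.
\<close>

record problem =
  \<sigma>\<^sub>1 :: real
  \<sigma>\<^sub>2 :: real
  rate :: real
  horizon :: real
  D\<^sub>1 :: real
  D\<^sub>2 :: real
  \<rho>\<^sub>1 :: real
  \<rho>\<^sub>2 :: real
  L\<^sub>W :: real
  L\<^sub>E :: real
  L\<^sub>S :: real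
  L\<^sub>N :: real
  N\<^sub>1 :: int
  N\<^sub>2 :: int
  dt :: real
  dirichlet :: "side set"
  g_init :: "real \<Rightarrow> real \<Rightarrow> real"
  g_neu :: "side \<Rightarrow> real \<Rightarrow> real \<Rightarrow> real \<Rightarrow> real"
  g_dir :: "real \<Rightarrow> real \<Rightarrow> real \<Rightarrow> real"

definition A\<^sub>1 :: "problem \<Rightarrow> real" where
  "A\<^sub>1 p = rate p - D\<^sub>1 p - (\<sigma>\<^sub>1 p)\<^sup>2 / 2"

definition A\<^sub>2 :: "problem \<Rightarrow> real" where
  "A\<^sub>2 p = rate p - D\<^sub>2 p - (\<sigma>\<^sub>2 p)\<^sup>2 / 2"

definition h\<^sub>1 :: "problem \<Rightarrow> real" where
  "h\<^sub>1 p = ln (L\<^sub>E p / L\<^sub>W p) / (of_int (N\<^sub>1 p) - 1)"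

definition h\<^sub>2 :: "problem \<Rightarrow> real" where
  "h\<^sub>2 p = ln (L\<^sub>N p / L\<^sub>S p) / (of_int (N\<^sub>2 p) - 1)"

definition x\<^sub>1 :: "problem \<Rightarrow> int \<Rightarrow> real" where
  "x\<^sub>1 p i = ln (L\<^sub>W p) + (of_int i - 1) * h\<^sub>1 p"

definition x\<^sub>2 :: "problem \<Rightarrow> int \<Rightarrow> real" where
  "x\<^sub>2 p j = ln (L\<^sub>S p) + (of_int j - 1) * h\<^sub>2 p"

definition time :: "problem \<Rightarrow> nat \<Rightarrow> real" where
  "time p n = real n * dt p"

definition b :: "problem \<Rightarrow> side \<Rightarrow> int" where
  "b p Q = (if Q \<in> dirichlet p then 1 else 0)"

definition rectangle :: "problem \<Rightarrow> (real \<times> real) set" where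
  "rectangle p = {ln (L\<^sub>W p)..ln (L\<^sub>E p)} \<times> {ln (L\<^sub>S p)..ln (L\<^sub>N p)}"

fun closed_side :: "problem \<Rightarrow> side \<Rightarrow> (real \<times> real) set" where
  "closed_side p West = {ln (L\<^sub>W p)} \<times> {ln (L\<^sub>S p)..ln (L\<^sub>N p)}"
| "closed_side p East = {ln (L\<^sub>E p)} \<times> {ln (L\<^sub>S p)..ln (L\<^sub>N p)}"
| "closed_side p South = {ln (L\<^sub>W p)..ln (L\<^sub>E p)} \<times> {ln (L\<^sub>S p)}"
| "closed_side p North = {ln (L\<^sub>W p)..ln (L\<^sub>E p)} \<times> {ln (L\<^sub>N p)}"

text \<open>The Neumann datum of a side at time \<open>\<tau>\<close>, as a grid function of the index along the side.\<close>

fun neumann :: "problem \<Rightarrow> real \<Rightarrow> side \<Rightarrow> int \<Rightarrow> real" where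
  "neumann p \<tau> West k = g_neu p West (x\<^sub>1 p 1) (x\<^sub>2 p k) \<tau>"
| "neumann p \<tau> East k = g_neu p East (x\<^sub>1 p (N\<^sub>1 p)) (x\<^sub>2 p k) \<tau>"
| "neumann p \<tau> South k = g_neu p South (x\<^sub>1 p k) (x\<^sub>2 p 1) \<tau>"
| "neumann p \<tau> North k = g_neu p North (x\<^sub>1 p k) (x\<^sub>2 p (N\<^sub>2 p)) \<tau>"

text \<open>
  \<open>ghost p Q k\<close>: the side \<open>Q\<close> ends at a corner between two Neumann sides, and \<open>k\<close> is the index of
  the node of its prolongation one mesh step beyond that corner.
\<close>

fun ghost :: "problem \<Rightarrow> side \<Rightarrow> int \<Rightarrow> bool" where
  "ghost p West k \<longleftrightarrow> West \<notin> dirichlet p \<and>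
     (k = 0 \<and> South \<notin> dirichlet p \<or> k = N\<^sub>2 p + 1 \<and> North \<notin> dirichlet p)"
| "ghost p East k \<longleftrightarrow> East \<notin> dirichlet p \<and>
     (k = 0 \<and> South \<notin> dirichlet p \<or> k = N\<^sub>2 p + 1 \<and> North \<notin> dirichlet p)"
| "ghost p South k \<longleftrightarrow> South \<notin> dirichlet p \<and>
     (k = 0 \<and> West \<notin> dirichlet p \<or> k = N\<^sub>1 p + 1 \<and> East \<notin> dirichlet p)"
| "ghost p North k \<longleftrightarrow> North \<notin> dirichlet p \<and>
     (k = 0 \<and> West \<notin> dirichlet p \<or> k = N\<^sub>1 p + 1 \<and> East \<notin> dirichlet p)"


section \<open>Differences\<close>

text \<open>
  \<open>fd\<close>, \<open>bd\<close>, \<open>cd\<close> are the forward, backward and central differences; the suffix is the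
  coordinate direction.
\<close>

definition fd :: "real \<Rightarrow> (int \<Rightarrow> real) \<Rightarrow> int \<Rightarrow> real" where
  "fd h w k = (w (k + 1) - w k) / h"

definition bd :: "real \<Rightarrow> (int \<Rightarrow> real) \<Rightarrow> int \<Rightarrow> real" where
  "bd h w k = (w k - w (k - 1)) / h"

definition cd :: "real \<Rightarrow> (int \<Rightarrow> real) \<Rightarrow> int \<Rightarrow> real" where
  "cd h w k = (fd h w k + bd h w k) / 2"

type_synonym grid = "int \<Rightarrow> int \<Rightarrow> real"

definition fd\<^sub>1 :: "problem \<Rightarrow> grid \<Rightarrow> grid" where
  "fd\<^sub>1 p u i j = fd (h\<^sub>1 p) (\<lambda>k. u k j) i"

definition bd\<^sub>1 :: "problem \<Rightarrow> grid \<Rightarrow> grid" where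
  "bd\<^sub>1 p u i j = bd (h\<^sub>1 p) (\<lambda>k. u k j) i"

definition cd\<^sub>1 :: "problem \<Rightarrow> grid \<Rightarrow> grid" where
  "cd\<^sub>1 p u i j = cd (h\<^sub>1 p) (\<lambda>k. u k j) i"

definition fd\<^sub>2 :: "problem \<Rightarrow> grid \<Rightarrow> grid" where
  "fd\<^sub>2 p u i j = fd (h\<^sub>2 p) (\<lambda>k. u i k) j"

definition bd\<^sub>2 :: "problem \<Rightarrow> grid \<Rightarrow> grid" where
  "bd\<^sub>2 p u i j = bd (h\<^sub>2 p) (\<lambda>k. u i k) j"

definition cd\<^sub>2 :: "problem \<Rightarrow> grid \<Rightarrow> grid" where
  "cd\<^sub>2 p u i j = cd (h\<^sub>2 p) (\<lambda>k. u i k) j"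

definition mixed_plus :: "problem \<Rightarrow> grid \<Rightarrow> grid" where
  "mixed_plus p u i j = (fd\<^sub>2 p (fd\<^sub>1 p u) i j + bd\<^sub>2 p (bd\<^sub>1 p u) i j) / 2"

definition mixed_minus :: "problem \<Rightarrow> grid \<Rightarrow> grid" where
  "mixed_minus p u i j = (fd\<^sub>2 p (bd\<^sub>1 p u) i j + bd\<^sub>2 p (fd\<^sub>1 p u) i j) / 2"

definition pos :: "real \<Rightarrow> real" where
  "pos v = max 0 v"

definition neg :: "real \<Rightarrow> real" where
  "neg v = max 0 (- v)"


section \<open>Flux limiter\<close>

definition \<Phi> :: "real \<Rightarrow> real" where
  "\<Phi> \<theta> = (\<bar>\<theta>\<bar> + \<theta>) / (1 + \<bar>\<theta>\<bar>)"

definition ratio :: "real \<Rightarrow> (int \<Rightarrow> real) \<Rightarrow> int \<Rightarrow> real" where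
  "ratio h w k = fd h w k / bd h w k"

text \<open>A line of \<open>N\<close> grid values with one extrapolated value at each end.\<close>

definition extrapolate :: "int \<Rightarrow> (int \<Rightarrow> real) \<Rightarrow> int \<Rightarrow> real" where
  "extrapolate N w k =
    (if k = 0 then 3 * w 1 - 3 * w 2 + w 3
     else if k = N + 1 then 3 * w N - 3 * w (N - 1) + w (N - 2)
     else w k)"

text \<open>
  \<open>v\<close> is an admissible value of the limiter factor at index \<open>k\<close> of the line \<open>w\<close>. It is prescribed
  by the formula when no denominator in the formula vanishes, and may otherwise be any number
  in \<open>[0, 2]\<close>, which covers every convention. The formula itself always lies in \<open>[0, 2]\<close>.
\<close>

definition is_\<Lambda>_plus :: "real \<Rightarrow> (int \<Rightarrow> real) \<Rightarrow> int \<Rightarrow> real \<Rightarrow> bool" where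
  "is_\<Lambda>_plus h w k v \<longleftrightarrow> 0 \<le> v \<and> v \<le> 2 \<and>
     (bd h w k \<noteq> 0 \<and> ratio h w k \<noteq> 0 \<and> bd h w (k + 1) \<noteq> 0 \<longrightarrow>
      v = 1 + \<Phi> (inverse (ratio h w k)) / 2 - \<Phi> (ratio h w (k + 1)) / 2)"

definition is_\<Lambda>_minus :: "real \<Rightarrow> (int \<Rightarrow> real) \<Rightarrow> int \<Rightarrow> real \<Rightarrow> bool" where
  "is_\<Lambda>_minus h w k v \<longleftrightarrow> 0 \<le> v \<and> v \<le> 2 \<and>
     (bd h w k \<noteq> 0 \<and> bd h w (k - 1) \<noteq> 0 \<and> ratio h w (k - 1) \<noteq> 0 \<longrightarrow>
      v = 1 + \<Phi> (ratio h w k) / 2 - \<Phi> (inverse (ratio h w (k - 1))) / 2)"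

text \<open>
  All limiter factors at the node \<open>(i, j)\<close>. On the last (first) grid line the plus (minus) factor
  does not occur in the scheme, and is left unconstrained.
\<close>

record limiter =
  \<Lambda>\<^sub>1_plus :: real
  \<Lambda>\<^sub>1_minus :: real
  \<Lambda>\<^sub>2_plus :: real
  \<Lambda>\<^sub>2_minus :: real

definition is_limiter :: "problem \<Rightarrow> grid \<Rightarrow> int \<Rightarrow> int \<Rightarrow> limiter \<Rightarrow> bool" where
  "is_limiter p u i j l \<longleftrightarrow>
     (let w1 = extrapolate (N\<^sub>1 p) (\<lambda>k. u k j); w2 = extrapolate (N\<^sub>2 p) (\<lambda>k. u i k) in
        (i < N\<^sub>1 p \<longrightarrow> is_\<Lambda>_plus (h\<^sub>1 p) w1 i (\<Lambda>\<^sub>1_plus l)) \<and>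
        (1 < i \<longrightarrow> is_\<Lambda>_minus (h\<^sub>1 p) w1 i (\<Lambda>\<^sub>1_minus l)) \<and>
        (j < N\<^sub>2 p \<longrightarrow> is_\<Lambda>_plus (h\<^sub>2 p) w2 j (\<Lambda>\<^sub>2_plus l)) \<and>
        (1 < j \<longrightarrow> is_\<Lambda>_minus (h\<^sub>2 p) w2 j (\<Lambda>\<^sub>2_minus l)))"


section \<open>The discrete operators\<close>

datatype node_kind = Inner | W_node | E_node | N_node | S_node
  | NW_corner | NE_corner | SE_corner | SW_corner

definition node_kind :: "problem \<Rightarrow> int \<Rightarrow> int \<Rightarrow> node_kind" where
  "node_kind p i j =
    (if i = 1 then (if j = 1 then SW_corner else if j = N\<^sub>2 p then NW_corner else W_node)
     else if i = N\<^sub>1 p then (if j = 1 then SE_corner else if j = N\<^sub>2 p then NE_corner else E_node)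
     else if j = 1 then S_node
     else if j = N\<^sub>2 p then N_node
     else Inner)"

text \<open>The argument of the function \<open>\<rho>(\<gamma>)\<close> at a node: the discrete mixed derivative.\<close>

definition \<gamma>_at :: "problem \<Rightarrow> real \<Rightarrow> grid \<Rightarrow> int \<Rightarrow> int \<Rightarrow> real" where
  "\<gamma>_at p \<tau> u i j =
    (let gW = neumann p \<tau> West; gE = neumann p \<tau> East;
         gS = neumann p \<tau> South; gN = neumann p \<tau> North;
         h1 = h\<^sub>1 p; h2 = h\<^sub>2 p
     in case node_kind p i j of
       Inner \<Rightarrow> cd\<^sub>2 p (cd\<^sub>1 p u) i j
     | W_node \<Rightarrow> - cd h2 gW j
     | E_node \<Rightarrow> cd h2 gE j
     | N_node \<Rightarrow> cd h1 gN i
     | S_node \<Rightarrow> - cd h1 gS i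
     | NW_corner \<Rightarrow> cd h1 gN i - cd h2 gW j
     | NE_corner \<Rightarrow> cd h1 gN i + cd h2 gE j
     | SE_corner \<Rightarrow> cd h2 gE j - cd h1 gS i
     | SW_corner \<Rightarrow> - cd h1 gS i - cd h2 gW j)"

text \<open>\<open>c\<close> is an admissible value of \<open>\<rho>(\<gamma>)\<close>; at \<open>\<gamma> = 0\<close> both correlations are.\<close>

definition is_\<rho> :: "problem \<Rightarrow> real \<Rightarrow> real \<Rightarrow> bool" where
  "is_\<rho> p \<gamma> c \<longleftrightarrow> (\<gamma> > 0 \<longrightarrow> c = \<rho>\<^sub>1 p) \<and> (\<gamma> < 0 \<longrightarrow> c = \<rho>\<^sub>2 p) \<and>
     (\<gamma> = 0 \<longrightarrow> c = \<rho>\<^sub>1 p \<or> c = \<rho>\<^sub>2 p)"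

definition B_op :: "problem \<Rightarrow> real \<Rightarrow> grid \<Rightarrow> int \<Rightarrow> int \<Rightarrow> real" where
  "B_op p c u i j =
    (let \<kappa> = \<sigma>\<^sub>1 p * \<sigma>\<^sub>2 p; s1 = (\<sigma>\<^sub>1 p)\<^sup>2; s2 = (\<sigma>\<^sub>2 p)\<^sup>2; h1 = h\<^sub>1 p; h2 = h\<^sub>2 p;
         f1 = fd\<^sub>1 p u i j; b1 = bd\<^sub>1 p u i j; f2 = fd\<^sub>2 p u i j; b2 = bd\<^sub>2 p u i j;
         u11 = fd\<^sub>1 p (bd\<^sub>1 p u) i j; u22 = fd\<^sub>2 p (bd\<^sub>2 p u) i j;
         ff = fd\<^sub>2 p (fd\<^sub>1 p u) i j; fb = bd\<^sub>2 p (fd\<^sub>1 p u) i j;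
         bf = fd\<^sub>2 p (bd\<^sub>1 p u) i j; bb = bd\<^sub>2 p (bd\<^sub>1 p u) i j
     in case node_kind p i j of
       Inner \<Rightarrow> - s1 / 2 * u11 - s2 / 2 * u22
                - \<kappa> * (pos c * mixed_plus p u i j - neg c * mixed_minus p u i j)
     | W_node \<Rightarrow> - s1 / h1 * f1 - s2 / 2 * u22 - \<kappa> / 2 * \<bar>c\<bar> * (ff - fb)
     | E_node \<Rightarrow> s1 / h1 * b1 - s2 / 2 * u22 - \<kappa> / 2 * \<bar>c\<bar> * (bb - bf)
     | N_node \<Rightarrow> - s1 / 2 * u11 + s2 / h2 * b2 - \<kappa> / 2 * \<bar>c\<bar> * (bb - fb)
     | S_node \<Rightarrow> - s1 / 2 * u11 - s2 / h2 * f2 - \<kappa> / 2 * \<bar>c\<bar> * (ff - bf)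
     | NW_corner \<Rightarrow> - s1 / h1 * f1 + s2 / h2 * b2 + \<kappa> * \<bar>c\<bar> * fb
     | NE_corner \<Rightarrow> s1 / h1 * b1 + s2 / h2 * b2 - \<kappa> * \<bar>c\<bar> * bb
     | SE_corner \<Rightarrow> s1 / h1 * b1 - s2 / h2 * f2 + \<kappa> * \<bar>c\<bar> * bf
     | SW_corner \<Rightarrow> - s1 / h1 * f1 - s2 / h2 * f2 - \<kappa> * \<bar>c\<bar> * ff)"

definition K_op :: "problem \<Rightarrow> limiter \<Rightarrow> grid \<Rightarrow> int \<Rightarrow> int \<Rightarrow> real" where
  "K_op p l u i j =
    (let K1p = pos (A\<^sub>1 p) * \<Lambda>\<^sub>1_plus l * fd\<^sub>1 p u i j;
         K1m = neg (A\<^sub>1 p) * \<Lambda>\<^sub>1_minus l * bd\<^sub>1 p u i j;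
         K2p = pos (A\<^sub>2 p) * \<Lambda>\<^sub>2_plus l * fd\<^sub>2 p u i j;
         K2m = neg (A\<^sub>2 p) * \<Lambda>\<^sub>2_minus l * bd\<^sub>2 p u i j
     in case node_kind p i j of
       Inner \<Rightarrow> (K1p - K1m) + (K2p - K2m)
     | W_node \<Rightarrow> K1p + (K2p - K2m)
     | E_node \<Rightarrow> - K1m + (K2p - K2m)
     | N_node \<Rightarrow> (K1p - K1m) - K2m
     | S_node \<Rightarrow> (K1p - K1m) + K2p
     | NW_corner \<Rightarrow> K1p - K2m
     | NE_corner \<Rightarrow> - K1m - K2m
     | SE_corner \<Rightarrow> - K1m + K2p
     | SW_corner \<Rightarrow> K1p + K2p)"

definition F_src :: "problem \<Rightarrow> real \<Rightarrow> real \<Rightarrow> int \<Rightarrow> int \<Rightarrow> real" where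
  "F_src p \<tau> c i j =
    (let \<kappa> = \<sigma>\<^sub>1 p * \<sigma>\<^sub>2 p; h1 = h\<^sub>1 p; h2 = h\<^sub>2 p;
         gW = neumann p \<tau> West; gE = neumann p \<tau> East;
         gS = neumann p \<tau> South; gN = neumann p \<tau> North;
         FW = (neg (A\<^sub>1 p) + (\<sigma>\<^sub>1 p)\<^sup>2 / h1) * gW j;
         FE = (pos (A\<^sub>1 p) + (\<sigma>\<^sub>1 p)\<^sup>2 / h1) * gE j;
         FN = (pos (A\<^sub>2 p) + (\<sigma>\<^sub>2 p)\<^sup>2 / h2) * gN i;
         FS = (neg (A\<^sub>2 p) + (\<sigma>\<^sub>2 p)\<^sup>2 / h2) * gS i
     in case node_kind p i j of
       Inner \<Rightarrow> 0
     | W_node \<Rightarrow> FW - \<kappa> * (pos c * bd h2 gW j - neg c * fd h2 gW j)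
     | E_node \<Rightarrow> FE + \<kappa> * (pos c * fd h2 gE j - neg c * bd h2 gE j)
     | N_node \<Rightarrow> FN + \<kappa> * (pos c * fd h1 gN i - neg c * bd h1 gN i)
     | S_node \<Rightarrow> FS - \<kappa> * (pos c * bd h1 gS i - neg c * fd h1 gS i)
     | NW_corner \<Rightarrow> FW + FN
         + \<kappa> * pos c * (fd h1 gN i - bd h2 gW j)
         + \<kappa> * neg c * (fd h1 gN i - bd h2 gW j + cd h2 gW j - cd h1 gN i)
     | NE_corner \<Rightarrow> FE + FN
         - \<kappa> * pos c * (bd h1 gN i + bd h2 gE j - cd h2 gE j - cd h1 gN i)
         - \<kappa> * neg c * (bd h1 gN i + bd h2 gE j)
     | SE_corner \<Rightarrow> FE + FS
         - \<kappa> * pos c * (bd h1 gS i - fd h2 gE j)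
         - \<kappa> * neg c * (bd h1 gS i - fd h2 gE j - cd h1 gS i + cd h2 gE j)
     | SW_corner \<Rightarrow> FW + FS
         + \<kappa> * pos c * (fd h1 gS i + fd h2 gW j)
         + \<kappa> * neg c * (fd h1 gS i + fd h2 gW j - cd h1 gS i - cd h2 gW j))"


section \<open>The scheme\<close>

definition dirichlet_node :: "problem \<Rightarrow> int \<Rightarrow> int \<Rightarrow> bool" where
  "dirichlet_node p i j \<longleftrightarrow>
     i = 1 \<and> West \<in> dirichlet p \<or> i = N\<^sub>1 p \<and> East \<in> dirichlet p \<or>
     j = 1 \<and> South \<in> dirichlet p \<or> j = N\<^sub>2 p \<and> North \<in> dirichlet p"

text \<open>
  \<open>u n i j\<close> is the numerical solution, \<open>c n i j\<close> the value of \<open>\<rho>'\<close> at the node \<open>(i, j)\<close> and level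
  \<open>n\<close>, and \<open>l n i j\<close> are the limiter factors there. In the step from level \<open>n\<close> to level
  \<open>Suc n\<close>, both \<open>c\<close> and \<open>l\<close> are taken at level \<open>n\<close>.
\<close>

definition numerical_solution ::
  "problem \<Rightarrow> (nat \<Rightarrow> grid) \<Rightarrow> (nat \<Rightarrow> grid) \<Rightarrow> (nat \<Rightarrow> int \<Rightarrow> int \<Rightarrow> limiter) \<Rightarrow> bool" where
  "numerical_solution p u c l \<longleftrightarrow>
     (\<forall>i \<in> {1..N\<^sub>1 p}. \<forall>j \<in> {1..N\<^sub>2 p}. u 0 i j = g_init p (x\<^sub>1 p i) (x\<^sub>2 p j)) \<and>
     (\<forall>n. time p (Suc n) \<le> horizon p \<longrightarrow> (\<forall>i \<in> {1..N\<^sub>1 p}. \<forall>j \<in> {1..N\<^sub>2 p}.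
        if dirichlet_node p i j
        then u (Suc n) i j = g_dir p (x\<^sub>1 p i) (x\<^sub>2 p j) (time p (Suc n))
        else is_\<rho> p (\<gamma>_at p (time p n) (u n) i j) (c n i j) \<and>
             is_limiter p (u n) i j (l n i j) \<and>
             (u (Suc n) i j - u n i j) / dt p + B_op p (c n i j) (u (Suc n)) i j
               + rate p * u (Suc n) i j
             = K_op p (l n i j) (u n) i j + F_src p (time p (Suc n)) (c n i j) i j))"

definition max_\<rho> :: "problem \<Rightarrow> grid \<Rightarrow> real" where
  "max_\<rho> p c = Max ((\<lambda>(i, j). \<bar>c i j\<bar>) `
     ({1 + b p West..N\<^sub>1 p - b p East} \<times> {1 + b p South..N\<^sub>2 p - b p North}))"

end

theory Submission
  imports Defs
begin

text \<open>
  The scheme obeys a discrete minimum principle. Suppose the values at level \<open>n\<close> are non-negative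
  and let \<open>(i, j)\<close> be a node where the values at level \<open>n + 1\<close> are minimal. The mesh condition says
  that the weights of the second differences dominate those of the mixed difference, so that
  the negative of the \<open>B\<close> term is a non-negative combination of increments away from \<open>(i, j)\<close>; the same
  two inequalities make the source term non-negative. The time step condition makes the explicit
  part a non-negative combination of old values. Hence
  \<open>(1 / \<triangle>\<tau> + r) u \<ge> 0\<close> at the minimum.
\<close>

section \<open>Positive and negative parts, and the position of the mesh nodes\<close>

lemma pos_nonneg: "0 \<le> pos v" and neg_nonneg: "0 \<le> neg v" and pos_add_neg: "pos v + neg v = \<bar>v\<bar>"
  by (auto simp: pos_def neg_def)

lemma h\<^sub>1_pos:
  assumes "0 < L\<^sub>W p" "L\<^sub>W p < L\<^sub>E p" "1 < N\<^sub>1 p"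
  shows "0 < h\<^sub>1 p"
  using assms by (simp add: h\<^sub>1_def)

lemma h\<^sub>2_pos:
  assumes "0 < L\<^sub>S p" "L\<^sub>S p < L\<^sub>N p" "1 < N\<^sub>2 p"
  shows "0 < h\<^sub>2 p"
  using assms by (simp add: h\<^sub>2_def)

lemma x\<^sub>1_first: "x\<^sub>1 p 1 = ln (L\<^sub>W p)"
  by (simp add: x\<^sub>1_def)

lemma x\<^sub>2_first: "x\<^sub>2 p 1 = ln (L\<^sub>S p)"
  by (simp add: x\<^sub>2_def)

lemma x\<^sub>1_last:
  assumes "0 < L\<^sub>W p" "L\<^sub>W p < L\<^sub>E p" "1 < N\<^sub>1 p"
  shows "x\<^sub>1 p (N\<^sub>1 p) = ln (L\<^sub>E p)"
  using assms by (simp add: x\<^sub>1_def h\<^sub>1_def ln_div)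

lemma x\<^sub>2_last:
  assumes "0 < L\<^sub>S p" "L\<^sub>S p < L\<^sub>N p" "1 < N\<^sub>2 p"
  shows "x\<^sub>2 p (N\<^sub>2 p) = ln (L\<^sub>N p)"
  using assms by (simp add: x\<^sub>2_def h\<^sub>2_def ln_div)

text \<open>The data are known to be non-negative only on the rectangle and its sides (apart from
  the ghost nodes), so the nodes have to be located there before the sign assumptions apply.\<close>

lemma x\<^sub>1_mem:
  assumes "0 < L\<^sub>W p" "L\<^sub>W p < L\<^sub>E p" "1 < N\<^sub>1 p" "i \<in> {1..N\<^sub>1 p}"
  shows "x\<^sub>1 p i \<in> {ln (L\<^sub>W p)..ln (L\<^sub>E p)}"
proof -
  have h: "0 < h\<^sub>1 p"
    using assms h\<^sub>1_pos by blast
  have "(of_int i - 1) * h\<^sub>1 p \<le> (of_int (N\<^sub>1 p) - 1) * h\<^sub>1 p"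
    using assms h by (intro mult_right_mono) auto
  then have "x\<^sub>1 p i \<le> x\<^sub>1 p (N\<^sub>1 p)"
    by (simp add: x\<^sub>1_def)
  moreover have "0 \<le> (of_int i - 1) * h\<^sub>1 p"
    using assms h by (intro mult_nonneg_nonneg) auto
  then have "ln (L\<^sub>W p) \<le> x\<^sub>1 p i"
    by (simp add: x\<^sub>1_def)
  ultimately show ?thesis
    using x\<^sub>1_last[OF assms(1-3)] by simp
qed

lemma x\<^sub>2_mem:
  assumes "0 < L\<^sub>S p" "L\<^sub>S p < L\<^sub>N p" "1 < N\<^sub>2 p" "j \<in> {1..N\<^sub>2 p}"
  shows "x\<^sub>2 p j \<in> {ln (L\<^sub>S p)..ln (L\<^sub>N p)}"
proof -
  have h: "0 < h\<^sub>2 p"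
    using assms h\<^sub>2_pos by blast
  have "(of_int j - 1) * h\<^sub>2 p \<le> (of_int (N\<^sub>2 p) - 1) * h\<^sub>2 p"
    using assms h by (intro mult_right_mono) auto
  then have "x\<^sub>2 p j \<le> x\<^sub>2 p (N\<^sub>2 p)"
    by (simp add: x\<^sub>2_def)
  moreover have "0 \<le> (of_int j - 1) * h\<^sub>2 p"
    using assms h by (intro mult_nonneg_nonneg) auto
  then have "ln (L\<^sub>S p) \<le> x\<^sub>2 p j"
    by (simp add: x\<^sub>2_def)
  ultimately show ?thesis
    using x\<^sub>2_last[OF assms(1-3)] by simp
qed

text \<open>The offsets \<open>b\<close> remove exactly the grid lines of the Dirichlet sides, so
  every other node is among the finitely many pairs over which the maximum runs.\<close>

lemma abs_le_max_\<rho>: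
  assumes "i \<in> {1..N\<^sub>1 p}" "j \<in> {1..N\<^sub>2 p}" "\<not> dirichlet_node p i j"
  shows "\<bar>c i j\<bar> \<le> max_\<rho> p c"
proof -
  have "(i, j) \<in> {1 + b p West..N\<^sub>1 p - b p East} \<times> {1 + b p South..N\<^sub>2 p - b p North}"
    using assms by (auto simp: dirichlet_node_def b_def)
  then show ?thesis
    unfolding max_\<rho>_def by (intro Max_ge) force+
qed

section \<open>The implicit operator at a minimum\<close>

text \<open>Every difference in \<open>B_op\<close> annihilates constants, so \<open>v\<close> may
  be replaced by its increments \<open>d\<close> from the minimum. The mixed differences give weight
  to diagonal neighbours and take it from axial ones; the mesh inequalities keep the axial weights
  non-negative.\<close>

lemma B_op_nonpos_at_minimum:
  fixes v :: grid
  assumes h: "0 < h\<^sub>1 p" "0 < h\<^sub>2 p" and \<sigma>: "0 < \<sigma>\<^sub>1 p" "0 < \<sigma>\<^sub>2 p"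
    and N: "1 < N\<^sub>1 p" "1 < N\<^sub>2 p"
    and mesh1: "\<sigma>\<^sub>2 p * \<bar>c\<bar> * h\<^sub>1 p \<le> \<sigma>\<^sub>1 p * h\<^sub>2 p"
    and mesh2: "\<sigma>\<^sub>1 p * \<bar>c\<bar> * h\<^sub>2 p \<le> \<sigma>\<^sub>2 p * h\<^sub>1 p"
    and ij: "i \<in> {1..N\<^sub>1 p}" "j \<in> {1..N\<^sub>2 p}"
    and minimum: "\<And>k m. k \<in> {1..N\<^sub>1 p} \<Longrightarrow> m \<in> {1..N\<^sub>2 p} \<Longrightarrow> v i j \<le> v k m"
  shows "B_op p c v i j \<le> 0"
proof -
  \<comment> \<open>\<open>a\<close>, \<open>e\<close> and \<open>q\<close> are the factors that the
    two pure second differences and the mixed difference put in front of grid values.\<close>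
  define a where "a = (\<sigma>\<^sub>1 p)\<^sup>2 / (h\<^sub>1 p)\<^sup>2"
  define e where "e = (\<sigma>\<^sub>2 p)\<^sup>2 / (h\<^sub>2 p)\<^sup>2"
  define q where "q = \<sigma>\<^sub>1 p * \<sigma>\<^sub>2 p / (h\<^sub>1 p * h\<^sub>2 p)"
  define d where "d k m = v k m - v i j" for k m
  have d: "0 \<le> d k m" if "k \<in> {1..N\<^sub>1 p}" "m \<in> {1..N\<^sub>2 p}" for k m
    using minimum that by (simp add: d_def)
  have q: "0 \<le> q"
    using h \<sigma> by (simp add: q_def)
  \<comment> \<open>This is \<open>mesh1\<close> multiplied by \<open>\<sigma>\<^sub>1 p\<close> and
    divided by the square of \<open>h\<^sub>1 p\<close> times \<open>h\<^sub>2 p\<close>.\<close>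
  have qa: "0 \<le> a - q * \<bar>c\<bar>"
  proof -
    have "\<sigma>\<^sub>1 p * (\<sigma>\<^sub>2 p * \<bar>c\<bar> * h\<^sub>1 p) \<le> \<sigma>\<^sub>1 p * (\<sigma>\<^sub>1 p * h\<^sub>2 p)"
      using mesh1 \<sigma> by simp
    then show ?thesis
      using h by (simp add: a_def q_def field_simps power2_eq_square)
  qed
  have qe: "0 \<le> e - q * \<bar>c\<bar>"
  proof -
    have "\<sigma>\<^sub>2 p * (\<sigma>\<^sub>1 p * \<bar>c\<bar> * h\<^sub>2 p) \<le> \<sigma>\<^sub>2 p * (\<sigma>\<^sub>2 p * h\<^sub>1 p)"
      using mesh2 \<sigma> by simp
    then show ?thesis
      using h by (simp add: e_def q_def field_simps power2_eq_square)
  qed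
  have abs_c: "\<bar>c\<bar> = pos c + neg c"
    by (simp add: pos_add_neg)
  note unf = B_op_def Let_def mixed_plus_def mixed_minus_def fd\<^sub>1_def fd\<^sub>2_def bd\<^sub>1_def bd\<^sub>2_def
    fd_def bd_def a_def e_def q_def d_def power2_eq_square
  show ?thesis
  proof (cases "node_kind p i j")
    case Inner
    then have r: "1 < i" "i < N\<^sub>1 p" "1 < j" "j < N\<^sub>2 p"
      using ij by (auto simp: node_kind_def split: if_splits)
    \<comment> \<open>The sign of \<open>c\<close> selects the diagonal: \<open>mixed_plus\<close>
      involves the north-east and south-west neighbours, \<open>mixed_minus\<close> the other two.
      Both diagonals thus get non-negative weight, and the four axial neighbours lose
      \<open>q * \<bar>c\<bar>\<close> in total share each.\<close>
    have "- B_op p c v i j =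
        ((a - q * \<bar>c\<bar>) * (d (i + 1) j + d (i - 1) j) + (e - q * \<bar>c\<bar>) * (d i (j + 1) + d i (j - 1))
         + q * pos c * (d (i + 1) (j + 1) + d (i - 1) (j - 1))
         + q * neg c * (d (i - 1) (j + 1) + d (i + 1) (j - 1))) / 2"
      unfolding abs_c using Inner h by (simp add: unf field_simps)
    also have "\<dots> \<ge> 0"
      using r q qa qe
      by (intro divide_nonneg_nonneg add_nonneg_nonneg mult_nonneg_nonneg d pos_nonneg neg_nonneg) auto
    finally show ?thesis by simp
  next
    case W_node
    then have r: "i = 1" "1 < j" "j < N\<^sub>2 p"
      using ij by (auto simp: node_kind_def split: if_splits)
    \<comment> \<open>Without a western neighbour, the eastern one carries the weight of both. The
      difference \<open>ff - fb\<close> treats the two inward diagonals alike, so only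
      \<open>\<bar>c\<bar>\<close> occurs.\<close>
    have "- B_op p c v i j =
        (a - q * \<bar>c\<bar>) * d (i + 1) j + (e - q * \<bar>c\<bar>) * (d i (j + 1) + d i (j - 1)) / 2
         + q * \<bar>c\<bar> * (d (i + 1) (j + 1) + d (i + 1) (j - 1)) / 2"
      using W_node h by (simp add: unf field_simps)
    also have "\<dots> \<ge> 0"
      using r q qa qe N by (intro divide_nonneg_nonneg add_nonneg_nonneg mult_nonneg_nonneg d) auto
    finally show ?thesis by simp
  next
    case E_node
    then have r: "i = N\<^sub>1 p" "1 < j" "j < N\<^sub>2 p"
      using ij by (auto simp: node_kind_def split: if_splits)
    have "- B_op p c v i j =
        (a - q * \<bar>c\<bar>) * d (i - 1) j + (e - q * \<bar>c\<bar>) * (d i (j + 1) + d i (j - 1)) / 2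
         + q * \<bar>c\<bar> * (d (i - 1) (j + 1) + d (i - 1) (j - 1)) / 2"
      using E_node h by (simp add: unf field_simps)
    also have "\<dots> \<ge> 0"
      using r q qa qe N by (intro divide_nonneg_nonneg add_nonneg_nonneg mult_nonneg_nonneg d) auto
    finally show ?thesis by simp
  next
    case N_node
    then have r: "1 < i" "i < N\<^sub>1 p" "j = N\<^sub>2 p"
      using ij by (auto simp: node_kind_def split: if_splits)
    have "- B_op p c v i j =
        (a - q * \<bar>c\<bar>) * (d (i + 1) j + d (i - 1) j) / 2 + (e - q * \<bar>c\<bar>) * d i (j - 1)
         + q * \<bar>c\<bar> * (d (i + 1) (j - 1) + d (i - 1) (j - 1)) / 2"
      using N_node h by (simp add: unf field_simps)
    also have "\<dots> \<ge> 0"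
      using r q qa qe N by (intro divide_nonneg_nonneg add_nonneg_nonneg mult_nonneg_nonneg d) auto
    finally show ?thesis by simp
  next
    case S_node
    then have r: "1 < i" "i < N\<^sub>1 p" "j = 1"
      using ij by (auto simp: node_kind_def split: if_splits)
    have "- B_op p c v i j =
        (a - q * \<bar>c\<bar>) * (d (i + 1) j + d (i - 1) j) / 2 + (e - q * \<bar>c\<bar>) * d i (j + 1)
         + q * \<bar>c\<bar> * (d (i + 1) (j + 1) + d (i - 1) (j + 1)) / 2"
      using S_node h by (simp add: unf field_simps)
    also have "\<dots> \<ge> 0"
      using r q qa qe N by (intro divide_nonneg_nonneg add_nonneg_nonneg mult_nonneg_nonneg d) auto
    finally show ?thesis by simp
  next
    case NW_corner
    then have r: "i = 1" "j = N\<^sub>2 p"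
      by (auto simp: node_kind_def split: if_splits)
    \<comment> \<open>Only three neighbours exist at a corner; the axial weights are twice those at
      an inner node.\<close>
    have "- B_op p c v i j =
        (a - q * \<bar>c\<bar>) * d (i + 1) j + (e - q * \<bar>c\<bar>) * d i (j - 1) + q * \<bar>c\<bar> * d (i + 1) (j - 1)"
      using NW_corner h by (simp add: unf field_simps)
    also have "\<dots> \<ge> 0"
      using r q qa qe N by (intro add_nonneg_nonneg mult_nonneg_nonneg d) auto
    finally show ?thesis by simp
  next
    case NE_corner
    then have r: "i = N\<^sub>1 p" "j = N\<^sub>2 p"
      by (auto simp: node_kind_def split: if_splits)
    have "- B_op p c v i j =
        (a - q * \<bar>c\<bar>) * d (i - 1) j + (e - q * \<bar>c\<bar>) * d i (j - 1) + q * \<bar>c\<bar> * d (i - 1) (j - 1)"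
      using NE_corner h by (simp add: unf field_simps)
    also have "\<dots> \<ge> 0"
      using r q qa qe N by (intro add_nonneg_nonneg mult_nonneg_nonneg d) auto
    finally show ?thesis by simp
  next
    case SE_corner
    then have r: "i = N\<^sub>1 p" "j = 1"
      by (auto simp: node_kind_def split: if_splits)
    have "- B_op p c v i j =
        (a - q * \<bar>c\<bar>) * d (i - 1) j + (e - q * \<bar>c\<bar>) * d i (j + 1) + q * \<bar>c\<bar> * d (i - 1) (j + 1)"
      using SE_corner h by (simp add: unf field_simps)
    also have "\<dots> \<ge> 0"
      using r q qa qe N by (intro add_nonneg_nonneg mult_nonneg_nonneg d) auto
    finally show ?thesis by simp
  next
    case SW_corner
    then have r: "i = 1" "j = 1"
      by (auto simp: node_kind_def split: if_splits)
    have "- B_op p c v i j =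
        (a - q * \<bar>c\<bar>) * d (i + 1) j + (e - q * \<bar>c\<bar>) * d i (j + 1) + q * \<bar>c\<bar> * d (i + 1) (j + 1)"
      using SW_corner h by (simp add: unf field_simps)
    also have "\<dots> \<ge> 0"
      using r q qa qe N by (intro add_nonneg_nonneg mult_nonneg_nonneg d) auto
    finally show ?thesis by simp
  qed
qed

section \<open>The source term from the Neumann data\<close>

text \<open>The sign of \<open>c\<close> selects the differences of the data so that neighbouring
  data enter with non-negative weight. Only the datum at the node itself loses weight, and the mesh
  inequalities ensure that \<open>\<sigma>\<^sub>1\<close> and \<open>\<sigma>\<^sub>2\<close> terms
  outweigh this loss.\<close>

lemma F_src_nonneg:
  assumes h: "0 < h\<^sub>1 p" "0 < h\<^sub>2 p" and \<sigma>: "0 < \<sigma>\<^sub>1 p" "0 < \<sigma>\<^sub>2 p"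
    and N: "1 < N\<^sub>1 p" "1 < N\<^sub>2 p"
    and mesh1: "\<sigma>\<^sub>2 p * \<bar>c\<bar> * h\<^sub>1 p \<le> \<sigma>\<^sub>1 p * h\<^sub>2 p"
    and mesh2: "\<sigma>\<^sub>1 p * \<bar>c\<bar> * h\<^sub>2 p \<le> \<sigma>\<^sub>2 p * h\<^sub>1 p"
    and ij: "i \<in> {1..N\<^sub>1 p}" "j \<in> {1..N\<^sub>2 p}"
    and node: "\<not> dirichlet_node p i j"
    and vertical: "\<And>Q k. Q \<in> {West, East} \<Longrightarrow> Q \<notin> dirichlet p \<Longrightarrow> k \<in> {1..N\<^sub>2 p} \<Longrightarrow>
      0 \<le> neumann p \<tau> Q k"
    and horizontal: "\<And>Q k. Q \<in> {South, North} \<Longrightarrow> Q \<notin> dirichlet p \<Longrightarrow> k \<in> {1..N\<^sub>1 p} \<Longrightarrow>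
      0 \<le> neumann p \<tau> Q k"
    and ghost: "\<And>Q k. ghost p Q k \<Longrightarrow> 0 \<le> neumann p \<tau> Q k"
  shows "0 \<le> F_src p \<tau> c i j"
proof -
  define gW gE gS gN where
    g_def: "gW = neumann p \<tau> West" "gE = neumann p \<tau> East"
      "gS = neumann p \<tau> South" "gN = neumann p \<tau> North"
  define \<kappa> where "\<kappa> = \<sigma>\<^sub>1 p * \<sigma>\<^sub>2 p"
  \<comment> \<open>\<open>a\<close> and \<open>e\<close> are what remains of the weight of the
    datum at the node after the differences along the side are subtracted. Up to a factor
    \<open>h\<^sub>1 p\<close> or \<open>h\<^sub>2 p\<close> they are the axial weights of the
    implicit operator.\<close>
  define a where "a = (\<sigma>\<^sub>1 p)\<^sup>2 / h\<^sub>1 p - \<kappa> * (pos c + neg c) / h\<^sub>2 p"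
  define e where "e = (\<sigma>\<^sub>2 p)\<^sup>2 / h\<^sub>2 p - \<kappa> * (pos c + neg c) / h\<^sub>1 p"
  have \<kappa>: "0 \<le> \<kappa> * pos c / h\<^sub>1 p" "0 \<le> \<kappa> * neg c / h\<^sub>1 p"
    "0 \<le> \<kappa> * pos c / h\<^sub>2 p" "0 \<le> \<kappa> * neg c / h\<^sub>2 p"
    using h \<sigma> pos_nonneg[of c] neg_nonneg[of c] by (auto simp: \<kappa>_def)
  have a: "0 \<le> a"
  proof -
    have "\<sigma>\<^sub>1 p * (\<sigma>\<^sub>2 p * \<bar>c\<bar> * h\<^sub>1 p) \<le> \<sigma>\<^sub>1 p * (\<sigma>\<^sub>1 p * h\<^sub>2 p)"
      using mesh1 \<sigma> by simp
    then show ?thesis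
      unfolding a_def \<kappa>_def pos_add_neg using h by (simp add: field_simps power2_eq_square)
  qed
  have e: "0 \<le> e"
  proof -
    have "\<sigma>\<^sub>2 p * (\<sigma>\<^sub>1 p * \<bar>c\<bar> * h\<^sub>2 p) \<le> \<sigma>\<^sub>2 p * (\<sigma>\<^sub>2 p * h\<^sub>1 p)"
      using mesh2 \<sigma> by simp
    then show ?thesis
      unfolding e_def \<kappa>_def pos_add_neg using h by (simp add: field_simps power2_eq_square)
  qed
  note A = pos_nonneg[of "A\<^sub>1 p"] neg_nonneg[of "A\<^sub>1 p"] pos_nonneg[of "A\<^sub>2 p"] neg_nonneg[of "A\<^sub>2 p"]
  note v = vertical[of West, folded g_def] vertical[of East, folded g_def]
    horizontal[of South, folded g_def] horizontal[of North, folded g_def]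
  note unf = F_src_def Let_def cd_def fd_def bd_def a_def e_def g_def[symmetric] \<kappa>_def[symmetric]
  show ?thesis
  proof (cases "node_kind p i j")
    case Inner
    then show ?thesis by (simp add: F_src_def Let_def)
  next
    case W_node
    then have r: "i = 1" "1 < j" "j < N\<^sub>2 p"
      using ij by (auto simp: node_kind_def split: if_splits)
    \<comment> \<open>Since \<open>1 < j\<close> and \<open>j < N\<^sub>2 p\<close>, both neighbours
      \<open>j - 1\<close> and \<open>j + 1\<close> still lie on the side, and no ghost value
      occurs.\<close>
    have "F_src p \<tau> c i j = (neg (A\<^sub>1 p) + a) * gW j
        + \<kappa> * pos c / h\<^sub>2 p * gW (j - 1) + \<kappa> * neg c / h\<^sub>2 p * gW (j + 1)"
      using W_node h by (simp add: unf field_simps)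
    also have "\<dots> \<ge> 0"
      using r a e \<kappa> A ij node
      by (intro add_nonneg_nonneg mult_nonneg_nonneg v) (auto simp: dirichlet_node_def)
    finally show ?thesis .
  next
    case E_node
    then have r: "i = N\<^sub>1 p" "1 < j" "j < N\<^sub>2 p"
      using ij by (auto simp: node_kind_def split: if_splits)
    have "F_src p \<tau> c i j = (pos (A\<^sub>1 p) + a) * gE j
        + \<kappa> * pos c / h\<^sub>2 p * gE (j + 1) + \<kappa> * neg c / h\<^sub>2 p * gE (j - 1)"
      using E_node h by (simp add: unf field_simps)
    also have "\<dots> \<ge> 0"
      using r a e \<kappa> A ij node
      by (intro add_nonneg_nonneg mult_nonneg_nonneg v) (auto simp: dirichlet_node_def)
    finally show ?thesis .
  next
    case N_node
    then have r: "1 < i" "i < N\<^sub>1 p" "j = N\<^sub>2 p"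
      using ij by (auto simp: node_kind_def split: if_splits)
    have "F_src p \<tau> c i j = (pos (A\<^sub>2 p) + e) * gN i
        + \<kappa> * pos c / h\<^sub>1 p * gN (i + 1) + \<kappa> * neg c / h\<^sub>1 p * gN (i - 1)"
      using N_node h by (simp add: unf field_simps)
    also have "\<dots> \<ge> 0"
      using r a e \<kappa> A ij node
      by (intro add_nonneg_nonneg mult_nonneg_nonneg v) (auto simp: dirichlet_node_def)
    finally show ?thesis .
  next
    case S_node
    then have r: "1 < i" "i < N\<^sub>1 p" "j = 1"
      using ij by (auto simp: node_kind_def split: if_splits)
    have "F_src p \<tau> c i j = (neg (A\<^sub>2 p) + e) * gS i
        + \<kappa> * pos c / h\<^sub>1 p * gS (i - 1) + \<kappa> * neg c / h\<^sub>1 p * gS (i + 1)"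
      using S_node h by (simp add: unf field_simps)
    also have "\<dots> \<ge> 0"
      using r a e \<kappa> A ij node
      by (intro add_nonneg_nonneg mult_nonneg_nonneg v) (auto simp: dirichlet_node_def)
    finally show ?thesis .
  next
    case NW_corner
    then have r: "i = 1" "j = N\<^sub>2 p"
      by (auto simp: node_kind_def split: if_splits)
    have sides: "West \<notin> dirichlet p" "North \<notin> dirichlet p"
      using r node by (auto simp: dirichlet_node_def)
    \<comment> \<open>The indices \<open>j + 1\<close> and \<open>i - 1\<close> are one step beyond
      the corner; their data are covered by \<open>ghost\<close>, the others by the assumptions on
      the sides.\<close>
    have g: "0 \<le> gW j" "0 \<le> gW (j - 1)" "0 \<le> gW (j + 1)"
      "0 \<le> gN i" "0 \<le> gN (i + 1)" "0 \<le> gN (i - 1)"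
      using sides r ij N
      by (auto intro: vertical[of West, folded g_def] horizontal[of North, folded g_def]
          ghost[of West, folded g_def] ghost[of North, folded g_def])
    \<comment> \<open>In the \<open>neg c\<close> part, one-sided and central differences combine to
      half a second difference, which yields the averages of two neighbours.\<close>
    have "F_src p \<tau> c i j = (neg (A\<^sub>1 p) + a) * gW j + (pos (A\<^sub>2 p) + e) * gN i
        + \<kappa> * pos c / h\<^sub>1 p * gN (i + 1) + \<kappa> * pos c / h\<^sub>2 p * gW (j - 1)
        + \<kappa> * neg c / h\<^sub>1 p * ((gN (i + 1) + gN (i - 1)) / 2)
        + \<kappa> * neg c / h\<^sub>2 p * ((gW (j + 1) + gW (j - 1)) / 2)"
      using NW_corner h by (simp add: unf field_simps)
    also have "\<dots> \<ge> 0"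
      using a e \<kappa> A g
      by (intro add_nonneg_nonneg mult_nonneg_nonneg) auto
    finally show ?thesis .
  next
    case NE_corner
    then have r: "i = N\<^sub>1 p" "j = N\<^sub>2 p"
      by (auto simp: node_kind_def split: if_splits)
    have sides: "East \<notin> dirichlet p" "North \<notin> dirichlet p"
      using r node by (auto simp: dirichlet_node_def)
    have g: "0 \<le> gE j" "0 \<le> gE (j - 1)" "0 \<le> gE (j + 1)"
      "0 \<le> gN i" "0 \<le> gN (i - 1)" "0 \<le> gN (i + 1)"
      using sides r ij N
      by (auto intro: vertical[of East, folded g_def] horizontal[of North, folded g_def]
          ghost[of East, folded g_def] ghost[of North, folded g_def])
    have "F_src p \<tau> c i j = (pos (A\<^sub>1 p) + a) * gE j + (pos (A\<^sub>2 p) + e) * gN i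
        + \<kappa> * pos c / h\<^sub>1 p * ((gN (i + 1) + gN (i - 1)) / 2)
        + \<kappa> * pos c / h\<^sub>2 p * ((gE (j + 1) + gE (j - 1)) / 2)
        + \<kappa> * neg c / h\<^sub>1 p * gN (i - 1)
        + \<kappa> * neg c / h\<^sub>2 p * gE (j - 1)"
      using NE_corner h by (simp add: unf field_simps)
    also have "\<dots> \<ge> 0"
      using a e \<kappa> A g
      by (intro add_nonneg_nonneg mult_nonneg_nonneg) auto
    finally show ?thesis .
  next
    case SE_corner
    then have r: "i = N\<^sub>1 p" "j = 1"
      by (auto simp: node_kind_def split: if_splits)
    have sides: "East \<notin> dirichlet p" "South \<notin> dirichlet p"
      using r node by (auto simp: dirichlet_node_def)
    have g: "0 \<le> gE j" "0 \<le> gE (j + 1)" "0 \<le> gE (j - 1)"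
      "0 \<le> gS i" "0 \<le> gS (i - 1)" "0 \<le> gS (i + 1)"
      using sides r ij N
      by (auto intro: vertical[of East, folded g_def] horizontal[of South, folded g_def]
          ghost[of East, folded g_def] ghost[of South, folded g_def])
    have "F_src p \<tau> c i j = (pos (A\<^sub>1 p) + a) * gE j + (neg (A\<^sub>2 p) + e) * gS i
        + \<kappa> * pos c / h\<^sub>1 p * gS (i - 1)
        + \<kappa> * pos c / h\<^sub>2 p * gE (j + 1)
        + \<kappa> * neg c / h\<^sub>1 p * ((gS (i + 1) + gS (i - 1)) / 2)
        + \<kappa> * neg c / h\<^sub>2 p * ((gE (j + 1) + gE (j - 1)) / 2)"
      using SE_corner h by (simp add: unf field_simps)
    also have "\<dots> \<ge> 0"
      using a e \<kappa> A g
      by (intro add_nonneg_nonneg mult_nonneg_nonneg) auto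
    finally show ?thesis .
  next
    case SW_corner
    then have r: "i = 1" "j = 1"
      by (auto simp: node_kind_def split: if_splits)
    have sides: "West \<notin> dirichlet p" "South \<notin> dirichlet p"
      using r node by (auto simp: dirichlet_node_def)
    have g: "0 \<le> gW j" "0 \<le> gW (j + 1)" "0 \<le> gW (j - 1)"
      "0 \<le> gS i" "0 \<le> gS (i + 1)" "0 \<le> gS (i - 1)"
      using sides r ij N
      by (auto intro: vertical[of West, folded g_def] horizontal[of South, folded g_def]
          ghost[of West, folded g_def] ghost[of South, folded g_def])
    have "F_src p \<tau> c i j = (neg (A\<^sub>1 p) + a) * gW j + (neg (A\<^sub>2 p) + e) * gS i
        + \<kappa> * pos c / h\<^sub>1 p * gS (i + 1)
        + \<kappa> * pos c / h\<^sub>2 p * gW (j + 1)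
        + \<kappa> * neg c / h\<^sub>1 p * ((gS (i + 1) + gS (i - 1)) / 2)
        + \<kappa> * neg c / h\<^sub>2 p * ((gW (j + 1) + gW (j - 1)) / 2)"
      using SW_corner h by (simp add: unf field_simps)
    also have "\<dots> \<ge> 0"
      using a e \<kappa> A g
      by (intro add_nonneg_nonneg mult_nonneg_nonneg) auto
    finally show ?thesis .
  qed
qed

section \<open>The explicit convection term and the time step\<close>

text \<open>Upwinding lets the neighbouring values enter with non-negative weight, so only the value
  at the node can make the term negative; limiter factors of at most 2 bound its weight.\<close>

lemma K_op_lower_bound:
  assumes h: "0 < h\<^sub>1 p" "0 < h\<^sub>2 p" and N: "1 < N\<^sub>1 p" "1 < N\<^sub>2 p"
    and ij: "i \<in> {1..N\<^sub>1 p}" "j \<in> {1..N\<^sub>2 p}"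
    and l: "is_limiter p w i j l"
    and w: "\<And>k m. k \<in> {1..N\<^sub>1 p} \<Longrightarrow> m \<in> {1..N\<^sub>2 p} \<Longrightarrow> 0 \<le> w k m"
  shows "- (2 * (\<bar>A\<^sub>1 p\<bar> / h\<^sub>1 p + \<bar>A\<^sub>2 p\<bar> / h\<^sub>2 p) * w i j) \<le> K_op p l w i j"
proof -
  \<comment> \<open>Here \<open>x\<close> is the value at the node, \<open>y\<close> that at its
    upwind neighbour and \<open>v\<close> the limiter factor: \<open>v * (y - x)\<close> is at least
    \<open>- v * x\<close>, hence at least \<open>- 2 * x\<close>.\<close>
  have upwind: "- (2 * (a / k) * x) \<le> a * v * ((y - x) / k)"
    if "0 \<le> v" "v \<le> 2" "0 \<le> a" "0 < k" "0 \<le> x" "0 \<le> y" for a v k x y :: real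
  proof -
    have "v * (- x) \<ge> 2 * (- x)"
      using that by (simp add: mult_right_mono)
    moreover have "v * (- x) \<le> v * (y - x)"
      using that by (intro mult_left_mono) auto
    ultimately have "2 * (- x) \<le> v * (y - x)" by linarith
    then have "a / k * (2 * (- x)) \<le> a / k * (v * (y - x))"
      using that by (intro mult_left_mono) auto
    then show ?thesis by (simp add: algebra_simps diff_divide_distrib)
  qed
  have wij: "0 \<le> w i j"
    using w ij by blast
  define P1 M1 P2 M2 where PM_def:
    "P1 = 2 * (pos (A\<^sub>1 p) / h\<^sub>1 p) * w i j" "M1 = 2 * (neg (A\<^sub>1 p) / h\<^sub>1 p) * w i j"
    "P2 = 2 * (pos (A\<^sub>2 p) / h\<^sub>2 p) * w i j" "M2 = 2 * (neg (A\<^sub>2 p) / h\<^sub>2 p) * w i j"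
  have nonneg: "0 \<le> P1" "0 \<le> M1" "0 \<le> P2" "0 \<le> M2"
    using wij h by (auto simp: PM_def intro!: mult_nonneg_nonneg divide_nonneg_pos pos_nonneg neg_nonneg)
  \<comment> \<open>The condition on \<open>i\<close> is what makes \<open>is_limiter\<close> bound
    this factor and keeps the neighbour on the grid; likewise in the next three facts.\<close>
  have 1: "- P1 \<le> pos (A\<^sub>1 p) * \<Lambda>\<^sub>1_plus l * fd\<^sub>1 p w i j" if "i < N\<^sub>1 p"
    unfolding PM_def fd\<^sub>1_def fd_def using that l ij
    by (intro upwind w wij h pos_nonneg) (auto simp: is_limiter_def Let_def is_\<Lambda>_plus_def)
  have 2: "neg (A\<^sub>1 p) * \<Lambda>\<^sub>1_minus l * bd\<^sub>1 p w i j \<le> M1" if "1 < i"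
  proof -
    \<comment> \<open>A backward difference is minus the increment towards \<open>i - 1\<close>,
      which brings it into the form of \<open>upwind\<close>.\<close>
    have "- M1 \<le> neg (A\<^sub>1 p) * \<Lambda>\<^sub>1_minus l * ((w (i - 1) j - w i j) / h\<^sub>1 p)"
      unfolding PM_def using that l ij
      by (intro upwind w wij h neg_nonneg) (auto simp: is_limiter_def Let_def is_\<Lambda>_minus_def)
    also have "\<dots> = - (neg (A\<^sub>1 p) * \<Lambda>\<^sub>1_minus l * bd\<^sub>1 p w i j)"
      using h by (simp add: bd\<^sub>1_def bd_def field_simps)
    finally show ?thesis by simp
  qed
  have 3: "- P2 \<le> pos (A\<^sub>2 p) * \<Lambda>\<^sub>2_plus l * fd\<^sub>2 p w i j" if "j < N\<^sub>2 p"
    unfolding PM_def fd\<^sub>2_def fd_def using that l ij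
    by (intro upwind w wij h pos_nonneg) (auto simp: is_limiter_def Let_def is_\<Lambda>_plus_def)
  have 4: "neg (A\<^sub>2 p) * \<Lambda>\<^sub>2_minus l * bd\<^sub>2 p w i j \<le> M2" if "1 < j"
  proof -
    have "- M2 \<le> neg (A\<^sub>2 p) * \<Lambda>\<^sub>2_minus l * ((w i (j - 1) - w i j) / h\<^sub>2 p)"
      unfolding PM_def using that l ij
      by (intro upwind w wij h neg_nonneg) (auto simp: is_limiter_def Let_def is_\<Lambda>_minus_def)
    also have "\<dots> = - (neg (A\<^sub>2 p) * \<Lambda>\<^sub>2_minus l * bd\<^sub>2 p w i j)"
      using h by (simp add: bd\<^sub>2_def bd_def field_simps)
    finally show ?thesis by simp
  qed
  have "2 * (\<bar>A\<^sub>1 p\<bar> / h\<^sub>1 p + \<bar>A\<^sub>2 p\<bar> / h\<^sub>2 p) * w i j = P1 + M1 + P2 + M2"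
    unfolding PM_def pos_add_neg[symmetric] by (simp add: add_divide_distrib algebra_simps)
  \<comment> \<open>Terms missing from \<open>K_op\<close> at the boundary do no harm, since their
    bounds in the sum on the left are non-negative.\<close>
  moreover have "- (P1 + M1 + P2 + M2) \<le> K_op p l w i j"
  proof (cases "node_kind p i j")
    case Inner
    then have "1 < i" "i < N\<^sub>1 p" "1 < j" "j < N\<^sub>2 p"
      using ij by (auto simp: node_kind_def split: if_splits)
    from 1[OF this(2)] 2[OF this(1)] 3[OF this(4)] 4[OF this(3)] nonneg show ?thesis
      using Inner by (simp add: K_op_def Let_def)
  next
    case W_node
    then have "i < N\<^sub>1 p" "1 < j" "j < N\<^sub>2 p"
      using ij N by (auto simp: node_kind_def split: if_splits)
    from 1[OF this(1)] 3[OF this(3)] 4[OF this(2)] nonneg show ?thesis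
      using W_node by (simp add: K_op_def Let_def)
  next
    case E_node
    then have "1 < i" "1 < j" "j < N\<^sub>2 p"
      using ij N by (auto simp: node_kind_def split: if_splits)
    from 2[OF this(1)] 3[OF this(3)] 4[OF this(2)] nonneg show ?thesis
      using E_node by (simp add: K_op_def Let_def)
  next
    case N_node
    then have "1 < i" "i < N\<^sub>1 p" "1 < j"
      using ij N by (auto simp: node_kind_def split: if_splits)
    from 1[OF this(2)] 2[OF this(1)] 4[OF this(3)] nonneg show ?thesis
      using N_node by (simp add: K_op_def Let_def)
  next
    case S_node
    then have "1 < i" "i < N\<^sub>1 p" "j < N\<^sub>2 p"
      using ij N by (auto simp: node_kind_def split: if_splits)
    from 1[OF this(2)] 2[OF this(1)] 3[OF this(3)] nonneg show ?thesis
      using S_node by (simp add: K_op_def Let_def)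
  next
    case NW_corner
    then have "i < N\<^sub>1 p" "1 < j"
      using N by (auto simp: node_kind_def split: if_splits)
    from 1[OF this(1)] 4[OF this(2)] nonneg show ?thesis
      using NW_corner by (simp add: K_op_def Let_def)
  next
    case NE_corner
    then have "1 < i" "1 < j"
      using N by (auto simp: node_kind_def split: if_splits)
    from 2[OF this(1)] 4[OF this(2)] nonneg show ?thesis
      using NE_corner by (simp add: K_op_def Let_def)
  next
    case SE_corner
    then have "1 < i" "j < N\<^sub>2 p"
      using N by (auto simp: node_kind_def split: if_splits)
    from 2[OF this(1)] 3[OF this(2)] nonneg show ?thesis
      using SE_corner by (simp add: K_op_def Let_def)
  next
    case SW_corner
    then have "i < N\<^sub>1 p" "j < N\<^sub>2 p"
      using N by (auto simp: node_kind_def split: if_splits)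
    from 1[OF this(1)] 3[OF this(2)] nonneg show ?thesis
      using SW_corner by (simp add: K_op_def Let_def)
  qed
  ultimately show ?thesis by simp
qed

text \<open>Dividing the time step condition by \<open>h\<^sub>1 p * h\<^sub>2 p\<close> bounds the
  negative weight from \<open>K_op_lower_bound\<close> by \<open>1 / dt p\<close>, so that
  \<open>w i j / dt p\<close> compensates it.\<close>

lemma explicit_part_nonneg:
  assumes h: "0 < h\<^sub>1 p" "0 < h\<^sub>2 p" and N: "1 < N\<^sub>1 p" "1 < N\<^sub>2 p" and dt: "0 < dt p"
    and time_step: "A\<^sub>1 p \<noteq> 0 \<or> A\<^sub>2 p \<noteq> 0 \<Longrightarrow>
      dt p \<le> h\<^sub>1 p * h\<^sub>2 p / (2 * (\<bar>A\<^sub>1 p\<bar> * h\<^sub>2 p + \<bar>A\<^sub>2 p\<bar> * h\<^sub>1 p))"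
    and ij: "i \<in> {1..N\<^sub>1 p}" "j \<in> {1..N\<^sub>2 p}"
    and l: "is_limiter p w i j l"
    and w: "\<And>k m. k \<in> {1..N\<^sub>1 p} \<Longrightarrow> m \<in> {1..N\<^sub>2 p} \<Longrightarrow> 0 \<le> w k m"
  shows "0 \<le> w i j / dt p + K_op p l w i j"
proof -
  let ?C = "2 * (\<bar>A\<^sub>1 p\<bar> / h\<^sub>1 p + \<bar>A\<^sub>2 p\<bar> / h\<^sub>2 p)"
  have "?C \<le> 1 / dt p"
  \<comment> \<open>If both coefficients vanish, the bound on the time step would be a division by
    zero, but then \<open>?C\<close> is 0.\<close>
  proof (cases "A\<^sub>1 p \<noteq> 0 \<or> A\<^sub>2 p \<noteq> 0")
    case True
    let ?S = "2 * (\<bar>A\<^sub>1 p\<bar> * h\<^sub>2 p + \<bar>A\<^sub>2 p\<bar> * h\<^sub>1 p)"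
    have "0 < ?S"
      using True h by (auto intro: add_pos_nonneg add_nonneg_pos)
    then have "dt p * ?S \<le> h\<^sub>1 p * h\<^sub>2 p"
      using time_step[OF True] by (simp add: pos_le_divide_eq)
    then show ?thesis
      using h dt by (simp add: field_simps)
  next
    case False
    then show ?thesis using dt by simp
  qed
  then have "?C * w i j \<le> 1 / dt p * w i j"
    using w ij by (intro mult_right_mono) auto
  then show ?thesis
    using K_op_lower_bound[OF h N ij l w] by simp
qed

section \<open>Induction over the time levels\<close>

theorem theorem5:
  fixes p :: problem
    and u c :: "nat \<Rightarrow> int \<Rightarrow> int \<Rightarrow> real"
    and l :: "nat \<Rightarrow> int \<Rightarrow> int \<Rightarrow> limiter"
  assumes "\<sigma>\<^sub>1 p > 0" and "\<sigma>\<^sub>2 p > 0" and "rate p > 0" and "horizon p > 0"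
    and "- 1 \<le> \<rho>\<^sub>1 p" and "\<rho>\<^sub>1 p \<le> \<rho>\<^sub>2 p" and "\<rho>\<^sub>2 p \<le> 1"
    and "0 < L\<^sub>W p" and "L\<^sub>W p < L\<^sub>E p" and "0 < L\<^sub>S p" and "L\<^sub>S p < L\<^sub>N p"
    and "N\<^sub>1 p \<ge> 4" and "N\<^sub>2 p \<ge> 4" and "dt p > 0"
    and "dirichlet p \<noteq> {}"
    and g_init_nonneg: "\<And>y z. (y, z) \<in> rectangle p \<Longrightarrow> g_init p y z \<ge> 0"
    and g_dir_nonneg: "\<And>Q y z \<tau>. \<lbrakk>Q \<in> dirichlet p; (y, z) \<in> closed_side p Q; 0 \<le> \<tau>; \<tau> \<le> horizon p\<rbrakk>
                         \<Longrightarrow> g_dir p y z \<tau> \<ge> 0"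
    and g_neu_nonneg: "\<And>Q y z \<tau>. \<lbrakk>Q \<notin> dirichlet p; (y, z) \<in> closed_side p Q; 0 \<le> \<tau>; \<tau> \<le> horizon p\<rbrakk>
                         \<Longrightarrow> g_neu p Q y z \<tau> \<ge> 0"
    and ghost_nonneg: "\<And>Q k \<tau>. \<lbrakk>ghost p Q k; 0 \<le> \<tau>; \<tau> \<le> horizon p\<rbrakk> \<Longrightarrow> neumann p \<tau> Q k \<ge> 0"
    and scheme: "numerical_solution p u c l"
    and mesh: "\<And>n. time p (Suc n) \<le> horizon p \<Longrightarrow>
                 \<sigma>\<^sub>1 p / \<sigma>\<^sub>2 p * max_\<rho> p (c n) \<le> h\<^sub>1 p / h\<^sub>2 p \<and>
                 (max_\<rho> p (c n) \<noteq> 0 \<longrightarrow> h\<^sub>1 p / h\<^sub>2 p \<le> \<sigma>\<^sub>1 p / (\<sigma>\<^sub>2 p * max_\<rho> p (c n)))"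
    and time_step: "A\<^sub>1 p \<noteq> 0 \<or> A\<^sub>2 p \<noteq> 0 \<Longrightarrow>
                      dt p \<le> h\<^sub>1 p * h\<^sub>2 p / (2 * (\<bar>A\<^sub>1 p\<bar> * h\<^sub>2 p + \<bar>A\<^sub>2 p\<bar> * h\<^sub>1 p))"
  shows "\<forall>n. time p n \<le> horizon p \<longrightarrow>
           (\<forall>i \<in> {1..N\<^sub>1 p}. \<forall>j \<in> {1..N\<^sub>2 p}. u n i j \<ge> 0)"
proof -
  note sig = assms(1,2) and r = assms(3) and L1 = assms(8,9) and L2 = assms(10,11) and dt = assms(14)
  have N: "1 < N\<^sub>1 p" "1 < N\<^sub>2 p"
    using assms(12,13) by auto
  have h: "0 < h\<^sub>1 p" "0 < h\<^sub>2 p"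
    using h\<^sub>1_pos[OF L1 N(1)] h\<^sub>2_pos[OF L2 N(2)] .
  note mem1 = x\<^sub>1_mem[OF L1 N(1)] and mem2 = x\<^sub>2_mem[OF L2 N(2)]
  note last1 = x\<^sub>1_last[OF L1 N(1)] and last2 = x\<^sub>2_last[OF L2 N(2)]
  have vertical: "0 \<le> neumann p \<tau> Q k"
    if "Q \<in> {West, East}" "Q \<notin> dirichlet p" "k \<in> {1..N\<^sub>2 p}" "0 \<le> \<tau>" "\<tau> \<le> horizon p" for Q k \<tau>
    using that mem2[of k] by (auto simp: x\<^sub>1_first last1 intro!: g_neu_nonneg)
  have horizontal: "0 \<le> neumann p \<tau> Q k"
    if "Q \<in> {South, North}" "Q \<notin> dirichlet p" "k \<in> {1..N\<^sub>1 p}" "0 \<le> \<tau>" "\<tau> \<le> horizon p" for Q k \<tau>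
    using that mem1[of k] by (auto simp: x\<^sub>2_first last2 intro!: g_neu_nonneg)
  have time_nonneg: "0 \<le> time p n" for n
    using dt by (simp add: time_def)
  have "\<forall>i \<in> {1..N\<^sub>1 p}. \<forall>j \<in> {1..N\<^sub>2 p}. 0 \<le> u n i j" if "time p n \<le> horizon p" for n
    using that
  proof (induction n)
    case 0
    show ?case
    proof (intro ballI)
      fix i j assume "i \<in> {1..N\<^sub>1 p}" "j \<in> {1..N\<^sub>2 p}"
      then show "0 \<le> u 0 i j"
        using scheme mem1[of i] mem2[of j] g_init_nonneg
        by (auto simp: numerical_solution_def rectangle_def)
    qed
  next
    case (Suc n)
    have "time p n \<le> time p (Suc n)"
      using dt by (simp add: time_def)
    then have old: "0 \<le> u n k m" if "k \<in> {1..N\<^sub>1 p}" "m \<in> {1..N\<^sub>2 p}" for k m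
      using Suc that by auto
    let ?G = "{1..N\<^sub>1 p} \<times> {1..N\<^sub>2 p}"
    define f where "f = (\<lambda>(k, m). u (Suc n) k m)"
    \<comment> \<open>The minimum is taken over the whole grid, Dirichlet nodes included, so it is
      enough to show that the value at the minimiser is non-negative.\<close>
    have "arg_min_on f ?G \<in> ?G" and "\<And>y. y \<in> ?G \<Longrightarrow> f (arg_min_on f ?G) \<le> f y"
      using N arg_min_if_finite(1)[of ?G f] arg_min_least[of ?G _ f] by auto
    then obtain i j where ij: "i \<in> {1..N\<^sub>1 p}" "j \<in> {1..N\<^sub>2 p}"
      and minimum: "\<And>k m. k \<in> {1..N\<^sub>1 p} \<Longrightarrow> m \<in> {1..N\<^sub>2 p} \<Longrightarrow> u (Suc n) i j \<le> u (Suc n) k m"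
      by (cases "arg_min_on f ?G") (force simp: f_def)
    have "0 \<le> u (Suc n) i j"
    proof (cases "dirichlet_node p i j")
      case True
      then obtain Q where "Q \<in> dirichlet p" "(x\<^sub>1 p i, x\<^sub>2 p j) \<in> closed_side p Q"
        using mem1[OF ij(1)] mem2[OF ij(2)]
        by (fastforce simp: dirichlet_node_def x\<^sub>1_first x\<^sub>2_first last1 last2)
      then have "0 \<le> g_dir p (x\<^sub>1 p i) (x\<^sub>2 p j) (time p (Suc n))"
        using g_dir_nonneg time_nonneg Suc.prems by blast
      then show ?thesis
        using scheme True Suc.prems ij by (auto simp: numerical_solution_def)
    next
      case False
      let ?c = "c n i j"
      have step: "is_limiter p (u n) i j (l n i j)"
        "(u (Suc n) i j - u n i j) / dt p + B_op p ?c (u (Suc n)) i j + rate p * u (Suc n) i j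
          = K_op p (l n i j) (u n) i j + F_src p (time p (Suc n)) ?c i j"
        using scheme False Suc.prems ij unfolding numerical_solution_def by auto
      let ?M = "max_\<rho> p (c n)"
      have M: "\<bar>?c\<bar> \<le> ?M"
        using abs_le_max_\<rho>[OF ij False] .
      \<comment> \<open>The left mesh inequality, cleared of denominators, gives
        \<open>mesh2\<close>; the right one gives \<open>mesh1\<close> below. In both,
        \<open>?M\<close> is then replaced by the smaller \<open>\<bar>?c\<bar>\<close>.\<close>
      have "\<sigma>\<^sub>1 p * ?M * h\<^sub>2 p \<le> \<sigma>\<^sub>2 p * h\<^sub>1 p"
        using mesh[OF Suc.prems] sig h by (simp add: field_simps)
      moreover have "\<sigma>\<^sub>1 p * \<bar>?c\<bar> * h\<^sub>2 p \<le> \<sigma>\<^sub>1 p * ?M * h\<^sub>2 p"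
        using M sig h by simp
      ultimately have mesh2: "\<sigma>\<^sub>1 p * \<bar>?c\<bar> * h\<^sub>2 p \<le> \<sigma>\<^sub>2 p * h\<^sub>1 p"
        by linarith
      \<comment> \<open>For \<open>?M = 0\<close> the upper bound of the mesh condition is infinite,
        and the product form holds trivially.\<close>
      have "\<sigma>\<^sub>2 p * ?M * h\<^sub>1 p \<le> \<sigma>\<^sub>1 p * h\<^sub>2 p"
      proof (cases "?M = 0")
        case True
        then show ?thesis using sig h by simp
      next
        case False
        then have "0 < ?M" using M by linarith
        moreover have "h\<^sub>1 p / h\<^sub>2 p \<le> \<sigma>\<^sub>1 p / (\<sigma>\<^sub>2 p * ?M)"
          using mesh[OF Suc.prems] False by blast
        ultimately show ?thesis using sig h by (simp add: field_simps)
      qed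
      moreover have "\<sigma>\<^sub>2 p * \<bar>?c\<bar> * h\<^sub>1 p \<le> \<sigma>\<^sub>2 p * ?M * h\<^sub>1 p"
        using M sig h by simp
      ultimately have mesh1: "\<sigma>\<^sub>2 p * \<bar>?c\<bar> * h\<^sub>1 p \<le> \<sigma>\<^sub>1 p * h\<^sub>2 p"
        by linarith
      have "B_op p ?c (u (Suc n)) i j \<le> 0"
        by (rule B_op_nonpos_at_minimum[OF h sig N mesh1 mesh2 ij], rule minimum)
      moreover have "0 \<le> F_src p (time p (Suc n)) ?c i j"
        using time_nonneg Suc.prems
        by (intro F_src_nonneg[OF h sig N mesh1 mesh2 ij False] vertical horizontal ghost_nonneg)
      moreover have "0 \<le> u n i j / dt p + K_op p (l n i j) (u n) i j"
        by (rule explicit_part_nonneg[OF h N dt time_step ij step(1)]) (auto intro: old)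
      \<comment> \<open>Solved for the new value, the scheme equates this expression with the
        explicit part plus the source minus the \<open>B_op\<close> term, all with the right
        sign.\<close>
      ultimately have "0 \<le> u (Suc n) i j / dt p + rate p * u (Suc n) i j"
        using step(2) by (simp add: diff_divide_distrib)
      then have "0 \<le> u (Suc n) i j * (1 / dt p + rate p)"
        by (simp add: algebra_simps)
      moreover have "0 < 1 / dt p + rate p"
        using dt r by (intro add_pos_pos) auto
      ultimately show ?thesis
        by (simp add: zero_le_mult_iff)
    qed
    with minimum show ?case
      by (meson order_trans)
  qed
  then show ?thesis by blast
qed

end
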